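(* Let $\mathscr{H}$ be a complex Hilbert space and let $B,C\in\mathbb{B}(\mathscr{H})$. Then for all $t\in[0,1]$, $$w_{e}(B,C) \leq \left\| t^2 B^*B+(1-t)^2C^*C\right\|^{\frac12}+ \frac1{\sqrt{2}}\left\lbrace w^2((1-t)B+tC)+ w^2((1-t)B-tC)\right\rbrace^{\frac12}.$$ In particular, for $t=\frac12$, $$w_{e}(B,C)\leq \frac12 \|B^*B+C^*C\|^{\frac12}+\frac{1}{2\sqrt{2}} \left\lbrace w^2(B+C)+w^2(B-C)\right\rbrace^{\frac12}.$$
   Context: $\mathbb{B}(\mathscr{H})$ denotes the bounded linear operators on $\mathscr{H}$, $\|\cdot\|$ the operator norm. The numerical radius is $w(T)=\sup\{|\langle Tx,x\rangle| : x\in\mathscr{H},\ \|x\|=1\}$, and $w^2(\cdot)$ means $(w(\cdot))^2$. The Euclidean operator radius of $B,C$ is $w_e(B,C)=\sup\left\{\sqrt{|\langle Bx,x\rangle|^2+|\langle Cx,x\rangle|^2} : x\in\mathscr{H},\ \|x\|=1\right\}$. *)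

theory Defs
  imports "HOL-Analysis.Analysis"
begin

class complex_vector = real_vector +
  fixes scaleC :: "complex \<Rightarrow> 'a \<Rightarrow> 'a"  (infixr "*\<^sub>C" 75)
  assumes scaleC_add_right: "a *\<^sub>C (x + y) = a *\<^sub>C x + a *\<^sub>C y"
    and scaleC_add_left: "(a + b) *\<^sub>C x = a *\<^sub>C x + b *\<^sub>C x"
    and scaleC_scaleC: "a *\<^sub>C b *\<^sub>C x = (a * b) *\<^sub>C x"
    and scaleC_one: "1 *\<^sub>C x = x"
    and scaleR_scaleC: "r *\<^sub>R x = complex_of_real r *\<^sub>C x"

text \<open>The inner product is linear in its first argument.  The norm axioms inherited from
  \<open>real_normed_vector\<close> follow from the inner product axioms and \<open>norm_eq_sqrt_cinner\<close>; inheriting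
  them restricts nothing and makes the library's topology and bounded operators available.\<close>

class complex_inner = complex_vector + real_normed_vector +
  fixes cinner :: "'a \<Rightarrow> 'a \<Rightarrow> complex"
  assumes cinner_commute: "cinner x y = cnj (cinner y x)"
    and cinner_add_left: "cinner (x + y) z = cinner x z + cinner y z"
    and cinner_scaleC_left: "cinner (c *\<^sub>C x) y = c * cinner x y"
    and cinner_ge_zero: "0 \<le> Re (cinner x x)"
    and cinner_eq_zero_iff: "cinner x x = 0 \<longleftrightarrow> x = 0"
    and norm_eq_sqrt_cinner: "norm x = sqrt (Re (cinner x x))"

class chilbert_space = complex_inner + complete_space

instantiation complex :: chilbert_space
begin

definition scaleC_complex :: "complex \<Rightarrow> complex \<Rightarrow> complex" where
  "scaleC_complex a x = a * x"

definition cinner_complex :: "complex \<Rightarrow> complex \<Rightarrow> complex" where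
  "cinner_complex x y = x * cnj y"

instance
proof
  fix a b x y z :: complex and r :: real
  show "a *\<^sub>C (x + y) = a *\<^sub>C x + a *\<^sub>C y"
    by (simp add: scaleC_complex_def distrib_left)
  show "(a + b) *\<^sub>C x = a *\<^sub>C x + b *\<^sub>C x"
    by (simp add: scaleC_complex_def distrib_right)
  show "a *\<^sub>C b *\<^sub>C x = (a * b) *\<^sub>C x"
    by (simp add: scaleC_complex_def mult.assoc)
  show "1 *\<^sub>C x = x"
    by (simp add: scaleC_complex_def)
  show "r *\<^sub>R x = complex_of_real r *\<^sub>C x"
    by (simp add: scaleC_complex_def scaleR_conv_of_real)
  show "cinner x y = cnj (cinner y x)"
    by (simp add: cinner_complex_def mult.commute)
  show "cinner (x + y) z = cinner x z + cinner y z"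
    by (simp add: cinner_complex_def distrib_right)
  show "cinner (a *\<^sub>C x) y = a * cinner x y"
    by (simp add: cinner_complex_def scaleC_complex_def mult.assoc)
  show "0 \<le> Re (cinner x x)"
    by (simp add: cinner_complex_def)
  show "cinner x x = 0 \<longleftrightarrow> x = 0"
    by (simp add: cinner_complex_def)
  show "norm x = sqrt (Re (cinner x x))"
    by (simp add: cinner_complex_def cmod_def power2_eq_square)
qed

end

text \<open>The library type of bounded operators only demands real linearity; a member of
  \<open>B(H)\<close> is such an operator satisfying in addition the following predicate.\<close>

definition complex_linear :: "('a::complex_inner \<Rightarrow>\<^sub>L 'a) \<Rightarrow> bool" where
  "complex_linear T \<longleftrightarrow> (\<forall>c x. blinfun_apply T (c *\<^sub>C x) = c *\<^sub>C blinfun_apply T x)"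

text \<open>On a Hilbert space the operator below exists and is unique for every complex linear \<open>T\<close>
  (Riesz), and it is then complex linear itself.\<close>

definition hilbert_adjoint :: "('a::chilbert_space \<Rightarrow>\<^sub>L 'a) \<Rightarrow> ('a \<Rightarrow>\<^sub>L 'a)" where
  "hilbert_adjoint T =
    (THE S. \<forall>x y. cinner (blinfun_apply T x) y = cinner x (blinfun_apply S y))"

text \<open>In the two suprema below, inserting \<open>0\<close> matters only for the zero space, which has no unit
  vectors: it fixes the supremum of the empty set of nonnegative reals to be \<open>0\<close>.\<close>

definition numerical_radius :: "('a::complex_inner \<Rightarrow>\<^sub>L 'a) \<Rightarrow> real" where
  "numerical_radius T =
    Sup (insert 0 {cmod (cinner (blinfun_apply T x) x) | x. norm x = 1})"

definition euclidean_operator_radius ::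
    "('a::complex_inner \<Rightarrow>\<^sub>L 'a) \<Rightarrow> ('a \<Rightarrow>\<^sub>L 'a) \<Rightarrow> real" where
  "euclidean_operator_radius B C =
    Sup (insert 0 {sqrt ((cmod (cinner (blinfun_apply B x) x))\<^sup>2 +
                         (cmod (cinner (blinfun_apply C x) x))\<^sup>2) | x. norm x = 1})"

end

theory Submission imports Defs begin

text \<open>For a unit vector \<open>x\<close>, with \<open>b = \<langle>Bx, x\<rangle>\<close> and \<open>c = \<langle>Cx, x\<rangle>\<close>, split
  \<open>(b, c) = (t b, (1 - t) c) + ((1 - t) b, t c)\<close> and apply the triangle inequality in the
  Euclidean plane.  By Cauchy--Schwarz the first summand is at most the square root of
  \<open>\<langle>(t\<^sup>2 B\<^sup>*B + (1 - t)\<^sup>2 C\<^sup>*C) x, x\<rangle>\<close>; the second is controlled by the parallelogram law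
  \<open>2 (|p|\<^sup>2 + |q|\<^sup>2) = |p + q|\<^sup>2 + |p - q|\<^sup>2\<close>.\<close>

section \<open>Inner product algebra and the Cauchy--Schwarz inequality\<close>

lemma cinner_add_right: "cinner (x::'a::complex_inner) (y + z) = cinner x y + cinner x z"
  by (metis cinner_add_left cinner_commute complex_cnj_add)

lemma cinner_scaleC_right: "cinner (x::'a::complex_inner) (c *\<^sub>C y) = cnj c * cinner x y"
  by (metis cinner_commute cinner_scaleC_left complex_cnj_mult)

lemma cinner_scaleR_left: "cinner (r *\<^sub>R (x::'a::complex_inner)) y = of_real r * cinner x y"
  by (simp add: scaleR_scaleC cinner_scaleC_left)

lemma cinner_scaleR_right: "cinner (x::'a::complex_inner) (r *\<^sub>R y) = of_real r * cinner x y"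
  by (simp add: scaleR_scaleC cinner_scaleC_right)

lemma cinner_minus_left: "cinner (- (x::'a::complex_inner)) y = - cinner x y"
  using cinner_scaleR_left[of "- 1" x y] by simp

lemma cinner_minus_right: "cinner (x::'a::complex_inner) (- y) = - cinner x y"
  using cinner_scaleR_right[of x "- 1" y] by simp

lemma cinner_diff_left: "cinner ((x::'a::complex_inner) - y) z = cinner x z - cinner y z"
  using cinner_add_left[of x "- y" z] by (simp add: cinner_minus_left)

lemma cinner_diff_right: "cinner (x::'a::complex_inner) (y - z) = cinner x y - cinner x z"
  using cinner_add_right[of x y "- z"] by (simp add: cinner_minus_right)

lemma Re_cinner_commute: "Re (cinner (y::'a::complex_inner) x) = Re (cinner x y)"
  using arg_cong[OF cinner_commute[of y x], of Re] by simp

lemma Re_cinner_self: "Re (cinner (x::'a::complex_inner) x) = (norm x)\<^sup>2"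
  by (simp add: norm_eq_sqrt_cinner cinner_ge_zero)

lemma cinner_self: "cinner (x::'a::complex_inner) x = of_real ((norm x)\<^sup>2)"
proof (rule complex_eqI)
  have "Im (cinner x x) = Im (cnj (cinner x x))"
    by (metis cinner_commute)
  then show "Im (cinner x x) = Im (of_real ((norm x)\<^sup>2))" by simp
qed (simp add: Re_cinner_self)

lemma norm_add_squared:
  "(norm ((x::'a::complex_inner) + y))\<^sup>2 = (norm x)\<^sup>2 + 2 * Re (cinner x y) + (norm y)\<^sup>2"
  by (simp add: Re_cinner_self[symmetric] cinner_add_left cinner_add_right Re_cinner_commute[of y x])

lemma norm_diff_squared:
  "(norm ((x::'a::complex_inner) - y))\<^sup>2 = (norm x)\<^sup>2 - 2 * Re (cinner x y) + (norm y)\<^sup>2"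
  using norm_add_squared[of x "- y"] by (simp add: cinner_minus_right)

lemma norm_scaleC: "norm (c *\<^sub>C (x::'a::complex_inner)) = cmod c * norm x"
proof -
  have "cinner (c *\<^sub>C x) (c *\<^sub>C x) = (c * cnj c) * cinner x x"
    by (simp add: cinner_scaleC_left cinner_scaleC_right)
  also have "\<dots> = of_real ((cmod c * norm x)\<^sup>2)"
    by (simp add: cinner_self complex_norm_square[symmetric] power_mult_distrib)
  finally have "(norm (c *\<^sub>C x))\<^sup>2 = (cmod c * norm x)\<^sup>2"
    by (metis Re_cinner_self Re_complex_of_real)
  then show ?thesis by simp
qed

text \<open>The triangle inequality comes with the normed space class, so expanding the square of
  \<open>norm (x + y)\<close> yields the real Cauchy--Schwarz inequality, reversing the usual
  derivation.\<close>

lemma Re_cinner_le_norm: "Re (cinner (x::'a::complex_inner) y) \<le> norm x * norm y"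
proof -
  have "(norm (x + y))\<^sup>2 \<le> (norm x + norm y)\<^sup>2"
    by (simp add: norm_triangle_ineq power_mono)
  then show ?thesis
    unfolding norm_add_squared by (simp add: power2_sum)
qed

lemma cmod_cinner_le_norm: "cmod (cinner (x::'a::complex_inner) y) \<le> norm x * norm y"
proof (cases "cinner x y = 0")
  case False
  \<comment> \<open>This unimodular factor rotates the inner product onto the nonnegative real axis
    while preserving \<open>norm x\<close>, which reduces the claim to the bound on real
    parts.\<close>
  define c where "c = cnj (sgn (cinner x y))"
  have c: "cmod c = 1" using False by (simp add: c_def norm_sgn)
  have "cinner (c *\<^sub>C x) y = of_real (cmod (cinner x y))"
    using False
    by (simp add: cinner_scaleC_left c_def sgn_eq field_simps complex_norm_square[symmetric]
        power2_eq_square)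
  then have "cmod (cinner x y) = Re (cinner (c *\<^sub>C x) y)" by simp
  also have "\<dots> \<le> norm x * norm y"
    using Re_cinner_le_norm[of "c *\<^sub>C x" y] by (simp add: norm_scaleC c)
  finally show ?thesis .
qed simp

lemma cinner_eq_imp_eq:
  assumes "\<And>x. cinner (x::'a::complex_inner) y = cinner x z"
  shows "y = z"
  using assms[of "y - z"] cinner_eq_zero_iff[of "y - z"] by (simp add: cinner_diff_right)

section \<open>Riesz representation and existence of adjoints\<close>

text \<open>The representing vector minimises \<open>\<parallel>y\<parallel>\<^sup>2 - 2 g y\<close>; the parallelogram law makes minimising
  sequences Cauchy.\<close>

lemma riesz_real:
  fixes g :: "'a::chilbert_space \<Rightarrow> real"
  assumes g: "bounded_linear g"
  shows "\<exists>u. \<forall>y. g y = Re (cinner y u)"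
proof -
  interpret g: bounded_linear g by fact
  define J where "J y = (norm y)\<^sup>2 - 2 * g y" for y
  obtain K where K: "\<And>y. norm (g y) \<le> norm y * K" using g.bounded by blast
  \<comment> \<open>Completing the square: \<open>J y\<close> is at least
    \<open>(norm y - K)^2 - K^2\<close>.\<close>
  have "- K\<^sup>2 \<le> J y" for y
  proof -
    have "g y \<le> norm y * K" using K[of y] by simp
    moreover have "0 \<le> (norm y - K)\<^sup>2" by simp
    ultimately show ?thesis unfolding J_def power2_diff by linarith
  qed
  then have bdd: "bdd_below (range J)" by (intro bdd_belowI2)
  define m where "m = Inf (range J)"
  have m: "m \<le> J y" for y unfolding m_def by (rule cInf_lower[OF _ bdd]) simp
  have "\<exists>y. J y < m + 1 / real (Suc n)" for n
    using cInf_lessD[of "range J" "m + 1 / real (Suc n)"] by (auto simp: m_def)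
  then obtain X where X: "\<And>n. J (X n) < m + 1 / real (Suc n)" by metis
  \<comment> \<open>Comparing \<open>m\<close> with \<open>J\<close> at the midpoint: by the
    parallelogram law the left side equals
    \<open>2 * J x + 2 * J y - 4 * J ((x + y) / 2)\<close>.\<close>
  have par: "(norm (x - y))\<^sup>2 \<le> 2 * (J x - m) + 2 * (J y - m)" for x y
  proof -
    have "J ((1/2) *\<^sub>R (x + y)) = (norm (x + y))\<^sup>2 / 4 - (g x + g y)"
      by (simp add: J_def g.scaleR g.add power_divide add_divide_distrib del: scaleR_add_right)
    then have "m \<le> (norm (x + y))\<^sup>2 / 4 - (g x + g y)"
      by (metis m)
    then show ?thesis
      unfolding norm_add_squared norm_diff_squared J_def by (simp add: field_simps)
  qed
  have "Cauchy X"
  proof (rule metric_CauchyI)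
    fix e :: real assume e: "0 < e"
    then obtain N where N: "4 / e\<^sup>2 < real N" using reals_Archimedean2 by blast
    have "dist (X i) (X j) < e" if "N \<le> i" "N \<le> j" for i j
    proof -
      have b: "J (X k) - m < e\<^sup>2 / 4" if "N \<le> k" for k
      proof -
        have "4 / e\<^sup>2 < real (Suc k)" using N that by linarith
        then have "1 / real (Suc k) < e\<^sup>2 / 4" using e by (simp add: field_simps)
        then show ?thesis using X[of k] by linarith
      qed
      note par[of "X i" "X j"]
      also have "2 * (J (X i) - m) + 2 * (J (X j) - m) < 2 * (e\<^sup>2 / 4) + 2 * (e\<^sup>2 / 4)"
        by (intro add_strict_mono mult_strict_left_mono b that) simp_all
      also have "\<dots> = e\<^sup>2" by simp
      finally have "(norm (X i - X j))\<^sup>2 < e\<^sup>2" .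
      then show ?thesis using e by (simp add: dist_norm power_less_imp_less_base)
    qed
    then show "\<exists>N. \<forall>i\<ge>N. \<forall>j\<ge>N. dist (X i) (X j) < e" by blast
  qed
  then obtain u where u: "X \<longlonglongrightarrow> u" using Cauchy_convergent convergent_def by blast
  have "(\<lambda>n. J (X n)) \<longlonglongrightarrow> J u"
    unfolding J_def by (intro tendsto_intros u g.tendsto)
  moreover have "(\<lambda>n. m + 1 / real (Suc n)) \<longlonglongrightarrow> m + 0"
    by (intro tendsto_add tendsto_const LIMSEQ_Suc[OF lim_1_over_n])
  ultimately have "J u \<le> m + 0"
    by (rule LIMSEQ_le) (use X in \<open>auto intro: less_imp_le\<close>)
  then have umin: "J u \<le> J y" for y using m[of y] by simp
  have "g y = Re (cinner y u)" for y
  proof -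
    define a where "a = Re (cinner u y) - g y"
    \<comment> \<open>Moving from \<open>u\<close> to \<open>u + s y\<close> changes
      \<open>J\<close> by \<open>2 s a + s^2 (norm y)^2\<close>. The optimal step would be
      \<open>- a / (norm y)^2\<close>; the added \<open>1\<close> keeps the denominator positive for
      \<open>y = 0\<close> and still makes the change negative unless \<open>a = 0\<close>.\<close>
    define s where "s = - a / ((norm y)\<^sup>2 + 1)"
    have n1: "0 < (norm y)\<^sup>2 + 1" by (simp add: add_nonneg_pos)
    have sa: "s * ((norm y)\<^sup>2 + 1) = - a" using n1 by (simp add: s_def)
    have "0 \<le> 2 * s * a + s\<^sup>2 * (norm y)\<^sup>2"
      using umin[of "u + s *\<^sub>R y"]
      by (simp add: J_def norm_add_squared g.add g.scaleR cinner_scaleR_right a_def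
          power_mult_distrib algebra_simps)
    also have "\<dots> = - s\<^sup>2 * ((norm y)\<^sup>2 + 2)"
    proof -
      have a: "a = - s * ((norm y)\<^sup>2 + 1)" using sa by linarith
      show ?thesis unfolding a by (simp add: algebra_simps power2_eq_square)
    qed
    finally have "s\<^sup>2 * ((norm y)\<^sup>2 + 2) \<le> 0" by simp
    then have "s = 0" using n1 by (simp add: mult_le_0_iff)
    then have "a = 0" using sa by simp
    then show ?thesis by (simp add: a_def Re_cinner_commute[of y u])
  qed
  then show ?thesis by blast
qed

text \<open>The real version represents \<open>Re f\<close>. Evaluating it at
  \<open>\<i> *\<^sub>C y\<close> recovers the imaginary part, because
  \<open>Re (\<i> z) = - Im z\<close>.\<close>

lemma riesz_complex:
  fixes f :: "'a::chilbert_space \<Rightarrow> complex"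
  assumes f: "bounded_linear f" and lin: "\<And>c x. f (c *\<^sub>C x) = c * f x"
  shows "\<exists>u. \<forall>y. f y = cinner y u"
proof -
  have "bounded_linear (\<lambda>y. Re (f y))"
    using bounded_linear_compose[OF bounded_linear_Re f] by simp
  then obtain u where u: "\<And>y. Re (f y) = Re (cinner y u)" using riesz_real by blast
  have "f y = cinner y u" for y
    using u[of y] u[of "\<i> *\<^sub>C y"] by (simp add: complex_eq_iff lin cinner_scaleC_left)
  then show ?thesis by blast
qed

lemma bounded_linear_cinner_left: "bounded_linear (\<lambda>x. cinner (x::'a::complex_inner) y)"
proof (rule bounded_linear_intro[where K="norm y"])
  show "cinner (r *\<^sub>R x) y = r *\<^sub>R cinner x y" for r and x :: 'a
    by (simp add: cinner_scaleR_left scaleR_conv_of_real)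
qed (simp_all add: cinner_add_left cmod_cinner_le_norm)

lemma adjoint_exists:
  fixes T :: "'a::chilbert_space \<Rightarrow>\<^sub>L 'a"
  assumes T: "complex_linear T"
  shows "\<exists>S :: 'a \<Rightarrow>\<^sub>L 'a. \<forall>x y. cinner (T x) y = cinner x (S y)"
proof -
  have "\<exists>u. \<forall>x. cinner (T x) y = cinner x u" for y
  proof (rule riesz_complex)
    show "bounded_linear (\<lambda>x. cinner (T x) y)"
      by (rule bounded_linear_compose[OF bounded_linear_cinner_left blinfun.bounded_linear_right])
    show "cinner (T (c *\<^sub>C x)) y = c * cinner (T x) y" for c x
      using T by (simp add: complex_linear_def cinner_scaleC_left)
  qed
  \<comment> \<open>Riesz yields \<open>S\<close> only pointwise; its additivity, homogeneity and
    boundedness are then read off from the adjoint identity.\<close>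
  then obtain S where S: "\<And>x y. cinner (T x) y = cinner x (S y)" by metis
  have "bounded_linear S"
  proof (rule bounded_linear_intro[where K="norm T"])
    show "S (y + z) = S y + S z" for y z
      by (rule cinner_eq_imp_eq) (simp add: S[symmetric] cinner_add_right)
    show "S (r *\<^sub>R y) = r *\<^sub>R S y" for r y
      by (rule cinner_eq_imp_eq) (simp add: S[symmetric] cinner_scaleR_right)
    show "norm (S y) \<le> norm y * norm T" for y
    proof (cases "S y = 0")
      \<comment> \<open>The identity at \<open>x = S y\<close> bounds \<open>(norm (S y))^2\<close>
        by \<open>norm T * norm (S y) * norm y\<close>, and the nonzero factor
        \<open>norm (S y)\<close> cancels.\<close>
      case False
      have "(norm (S y))\<^sup>2 = Re (cinner (T (S y)) y)" by (simp add: S Re_cinner_self)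
      also have "\<dots> \<le> norm (T (S y)) * norm y" by (rule Re_cinner_le_norm)
      also have "\<dots> \<le> norm T * norm (S y) * norm y"
        by (intro mult_right_mono norm_blinfun) simp
      finally show ?thesis using False by (simp add: power2_eq_square mult_ac)
    qed simp
  qed
  then have "\<forall>x y. cinner (T x) y = cinner x (Blinfun S y)"
    by (simp add: bounded_linear_Blinfun_apply S)
  then show ?thesis by blast
qed

text \<open>Existence together with uniqueness makes the definite description meaningful; all later
  reasoning about the adjoint goes through this identity.\<close>

lemma cinner_hilbert_adjoint:
  fixes T :: "'a::chilbert_space \<Rightarrow>\<^sub>L 'a"
  assumes "complex_linear T"
  shows "cinner (T x) y = cinner x (hilbert_adjoint T y)"
proof -
  have "\<exists>!S :: 'a \<Rightarrow>\<^sub>L 'a. \<forall>x y. cinner (T x) y = cinner x (S y)"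
  proof (rule ex_ex1I[OF adjoint_exists[OF assms]])
    fix S S' :: "'a \<Rightarrow>\<^sub>L 'a"
    assume "\<forall>x y. cinner (T x) y = cinner x (S y)" "\<forall>x y. cinner (T x) y = cinner x (S' y)"
    then show "S = S'" by (metis blinfun_eqI cinner_eq_imp_eq)
  qed
  from theI'[OF this] show ?thesis unfolding hilbert_adjoint_def by blast
qed

section \<open>Numerical radii\<close>

lemma cmod_cinner_apply_le_norm:
  fixes T :: "'a::complex_inner \<Rightarrow>\<^sub>L 'a"
  assumes "norm x = 1"
  shows "cmod (cinner (T x) x) \<le> norm T"
  using cmod_cinner_le_norm[of "T x" x] norm_blinfun[of T x] assms by simp

text \<open>The operator norm bounds the set of values, so its real supremum is a genuine upper
  bound.\<close>

lemma cmod_cinner_le_numerical_radius: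
  fixes T :: "'a::complex_inner \<Rightarrow>\<^sub>L 'a"
  assumes "norm x = 1"
  shows "cmod (cinner (T x) x) \<le> numerical_radius T"
proof -
  have "bdd_above (insert 0 {cmod (cinner (T x) x) | x. norm x = 1})"
    by (rule bdd_aboveI[where M="norm T"]) (auto intro: cmod_cinner_apply_le_norm)
  then show ?thesis
    unfolding numerical_radius_def by (rule cSup_upper[rotated]) (use assms in blast)
qed

text \<open>The inserted \<open>0\<close> belongs to the set, which covers the zero space as
  well.\<close>

lemma numerical_radius_nonneg: "0 \<le> numerical_radius (T :: 'a::complex_inner \<Rightarrow>\<^sub>L 'a)"
proof -
  have "bdd_above (insert 0 {cmod (cinner (T x) x) | x. norm x = 1})"
    by (rule bdd_aboveI[where M="norm T"]) (auto intro: cmod_cinner_apply_le_norm)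
  then show ?thesis
    unfolding numerical_radius_def by (rule cSup_upper[rotated]) blast
qed

lemma numerical_radius_scaleR_le:
  fixes T :: "'a::complex_inner \<Rightarrow>\<^sub>L 'a"
  shows "numerical_radius (r *\<^sub>R T) \<le> \<bar>r\<bar> * numerical_radius T"
  unfolding numerical_radius_def[of "r *\<^sub>R T"]
proof (rule cSup_least)
  fix v assume "v \<in> insert 0 {cmod (cinner ((r *\<^sub>R T) x) x) | x. norm x = 1}"
  then show "v \<le> \<bar>r\<bar> * numerical_radius T"
    by (auto simp: numerical_radius_nonneg blinfun.scaleR_left cinner_scaleR_left norm_mult
        intro!: mult_left_mono cmod_cinner_le_numerical_radius)
qed simp

section \<open>Bounds for the two summands of the splitting\<close>

lemma weighted_cmod_cinner_le:
  fixes B C :: "'a::chilbert_space \<Rightarrow>\<^sub>L 'a"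
  assumes B: "complex_linear B" and C: "complex_linear C" and x: "norm x = 1"
  shows "(s * cmod (cinner (B x) x))\<^sup>2 + (t * cmod (cinner (C x) x))\<^sup>2
    \<le> norm (s\<^sup>2 *\<^sub>R (hilbert_adjoint B o\<^sub>L B) + t\<^sup>2 *\<^sub>R (hilbert_adjoint C o\<^sub>L C))"
    (is "_ \<le> norm ?M")
proof -
  \<comment> \<open>This turns the quadratic form of \<open>?M\<close> at \<open>x\<close> into a
    weighted sum of \<open>(norm (B x))^2\<close> and \<open>(norm (C x))^2\<close>.\<close>
  have adj: "Re (cinner (hilbert_adjoint T (T x)) x) = (norm (T x))\<^sup>2"
    if "complex_linear T" for T :: "'a \<Rightarrow>\<^sub>L 'a"
    using cinner_hilbert_adjoint[OF that, of x "T x"]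
    by (metis Re_cinner_commute Re_cinner_self)
  have le: "(cmod (cinner (T x) x))\<^sup>2 \<le> (norm (T x))\<^sup>2" for T :: "'a \<Rightarrow>\<^sub>L 'a"
    using cmod_cinner_le_norm[of "T x" x] x by (intro power_mono) simp_all
  have "(s * cmod (cinner (B x) x))\<^sup>2 + (t * cmod (cinner (C x) x))\<^sup>2
      \<le> s\<^sup>2 * (norm (B x))\<^sup>2 + t\<^sup>2 * (norm (C x))\<^sup>2"
    unfolding power_mult_distrib by (intro add_mono mult_left_mono le) simp_all
  also have "\<dots> = Re (cinner (?M x) x)"
    by (simp add: blinfun.add_left blinfun.scaleR_left cinner_add_left cinner_scaleR_left
        adj[OF B] adj[OF C] flip: of_real_power)
  also have "\<dots> \<le> norm ?M"
    using complex_Re_le_cmod cmod_cinner_apply_le_norm[OF x] by (rule order_trans)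
  finally show ?thesis .
qed

text \<open>The sum and difference of the two inner products are values of the forms of
  \<open>P + Q\<close> and \<open>P - Q\<close> at the same \<open>x\<close>, so the parallelogram
  law allows each to be bounded by its own radius.\<close>

lemma cmod_cinner_sum_le_numerical_radius:
  fixes P Q :: "'a::complex_inner \<Rightarrow>\<^sub>L 'a"
  assumes x: "norm x = 1"
  shows "(cmod (cinner (P x) x))\<^sup>2 + (cmod (cinner (Q x) x))\<^sup>2
    \<le> ((numerical_radius (P + Q))\<^sup>2 + (numerical_radius (P - Q))\<^sup>2) / 2"
proof -
  have parallelogram: "2 * ((cmod p)\<^sup>2 + (cmod q)\<^sup>2) = (cmod (p + q))\<^sup>2 + (cmod (p - q))\<^sup>2" for p q
    unfolding cmod_power2 by (simp add: power2_eq_square algebra_simps)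
  have "cmod (cinner (P x) x + cinner (Q x) x) \<le> numerical_radius (P + Q)"
    using cmod_cinner_le_numerical_radius[OF x, of "P + Q"]
    by (simp add: blinfun.add_left cinner_add_left)
  moreover have "cmod (cinner (P x) x - cinner (Q x) x) \<le> numerical_radius (P - Q)"
    using cmod_cinner_le_numerical_radius[OF x, of "P - Q"]
    by (simp add: blinfun.diff_left cinner_diff_left)
  ultimately have "(cmod (cinner (P x) x + cinner (Q x) x))\<^sup>2 \<le> (numerical_radius (P + Q))\<^sup>2"
    and "(cmod (cinner (P x) x - cinner (Q x) x))\<^sup>2 \<le> (numerical_radius (P - Q))\<^sup>2"
    by (simp_all add: power_mono)
  then have "2 * ((cmod (cinner (P x) x))\<^sup>2 + (cmod (cinner (Q x) x))\<^sup>2)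
      \<le> (numerical_radius (P + Q))\<^sup>2 + (numerical_radius (P - Q))\<^sup>2"
    unfolding parallelogram by (rule add_mono)
  then show ?thesis by simp
qed

lemma euclidean_operator_radius_le:
  fixes B C :: "'a::chilbert_space \<Rightarrow>\<^sub>L 'a"
  assumes B: "complex_linear B" and C: "complex_linear C" and t: "0 \<le> t" "t \<le> 1"
  shows "euclidean_operator_radius B C
        \<le> sqrt (norm (t\<^sup>2 *\<^sub>R (hilbert_adjoint B o\<^sub>L B)
                      + (1 - t)\<^sup>2 *\<^sub>R (hilbert_adjoint C o\<^sub>L C)))
          + 1 / sqrt 2 * sqrt ((numerical_radius ((1 - t) *\<^sub>R B + t *\<^sub>R C))\<^sup>2
                               + (numerical_radius ((1 - t) *\<^sub>R B - t *\<^sub>R C))\<^sup>2)"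
    (is "_ \<le> sqrt (norm ?M) + 1 / sqrt 2 * sqrt ?W")
  unfolding euclidean_operator_radius_def
proof (rule cSup_least)
  have bound: "sqrt ((cmod (cinner (B x) x))\<^sup>2 + (cmod (cinner (C x) x))\<^sup>2)
      \<le> sqrt (norm ?M) + 1 / sqrt 2 * sqrt ?W" if x: "norm x = 1" for x
  proof -
    \<comment> \<open>Splitting the moduli instead of the complex values lets the triangle
      inequality of the real plane suffice.\<close>
    define b where "b = cmod (cinner (B x) x)"
    define c where "c = cmod (cinner (C x) x)"
    \<comment> \<open>The range of \<open>t\<close> enters here: nonnegative weights leave the
      modulus without an absolute value.\<close>
    have scale: "cmod (cinner ((r *\<^sub>R T) x) x) = r * cmod (cinner (T x) x)"
      if "0 \<le> r" for r and T :: "'a \<Rightarrow>\<^sub>L 'a"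
      using that by (simp add: blinfun.scaleR_left cinner_scaleR_left norm_mult)
    have "((1 - t) * b)\<^sup>2 + (t * c)\<^sup>2 \<le> ?W / 2"
      using cmod_cinner_sum_le_numerical_radius[OF x, of "(1 - t) *\<^sub>R B" "t *\<^sub>R C"] t
      by (simp only: scale b_def c_def diff_ge_0_iff_ge)
    then have "sqrt (((1 - t) * b)\<^sup>2 + (t * c)\<^sup>2) \<le> sqrt (?W / 2)"
      by (rule real_sqrt_le_mono)
    also have "\<dots> = 1 / sqrt 2 * sqrt ?W"
      by (simp only: real_sqrt_divide times_divide_eq_left mult_1_left)
    finally have second: "sqrt (((1 - t) * b)\<^sup>2 + (t * c)\<^sup>2) \<le> 1 / sqrt 2 * sqrt ?W" .
    have first: "sqrt ((t * b)\<^sup>2 + ((1 - t) * c)\<^sup>2) \<le> sqrt (norm ?M)"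
      unfolding b_def c_def by (intro real_sqrt_le_mono weighted_cmod_cinner_le B C x)
    have "sqrt (b\<^sup>2 + c\<^sup>2) = sqrt ((t * b + (1 - t) * b)\<^sup>2 + ((1 - t) * c + t * c)\<^sup>2)"
      by (simp flip: distrib_right)
    also have "\<dots> \<le> sqrt ((t * b)\<^sup>2 + ((1 - t) * c)\<^sup>2) + sqrt (((1 - t) * b)\<^sup>2 + (t * c)\<^sup>2)"
      by (rule real_sqrt_sum_squares_triangle_ineq)
    finally show ?thesis using first second unfolding b_def c_def by linarith
  qed
  fix v
  assume "v \<in> insert 0 {sqrt ((cmod (cinner (B x) x))\<^sup>2 + (cmod (cinner (C x) x))\<^sup>2) | x. norm x = 1}"
  \<comment> \<open>The inserted value \<open>0\<close> is covered because the right-hand side is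
    nonnegative.\<close>
  then show "v \<le> sqrt (norm ?M) + 1 / sqrt 2 * sqrt ?W"
    using bound by auto
qed simp

theorem theorem2p9:
  fixes B C :: "'a::chilbert_space \<Rightarrow>\<^sub>L 'a"
  assumes "complex_linear B" and "complex_linear C"
  shows "(\<forall>t::real. 0 \<le> t \<and> t \<le> 1 \<longrightarrow>
      euclidean_operator_radius B C
        \<le> sqrt (norm (t\<^sup>2 *\<^sub>R (hilbert_adjoint B o\<^sub>L B)
                      + (1 - t)\<^sup>2 *\<^sub>R (hilbert_adjoint C o\<^sub>L C)))
          + 1 / sqrt 2 * sqrt ((numerical_radius ((1 - t) *\<^sub>R B + t *\<^sub>R C))\<^sup>2
                               + (numerical_radius ((1 - t) *\<^sub>R B - t *\<^sub>R C))\<^sup>2))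
    \<and> euclidean_operator_radius B C
        \<le> 1 / 2 * sqrt (norm ((hilbert_adjoint B o\<^sub>L B) + (hilbert_adjoint C o\<^sub>L C)))
          + 1 / (2 * sqrt 2) * sqrt ((numerical_radius (B + C))\<^sup>2
                                     + (numerical_radius (B - C))\<^sup>2)"
proof (intro conjI allI impI)
  fix t :: real
  assume "0 \<le> t \<and> t \<le> 1"
  then show "euclidean_operator_radius B C
        \<le> sqrt (norm (t\<^sup>2 *\<^sub>R (hilbert_adjoint B o\<^sub>L B)
                      + (1 - t)\<^sup>2 *\<^sub>R (hilbert_adjoint C o\<^sub>L C)))
          + 1 / sqrt 2 * sqrt ((numerical_radius ((1 - t) *\<^sub>R B + t *\<^sub>R C))\<^sup>2
                               + (numerical_radius ((1 - t) *\<^sub>R B - t *\<^sub>R C))\<^sup>2)"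
    using euclidean_operator_radius_le[OF assms] by blast
next
  let ?N = "(hilbert_adjoint B o\<^sub>L B) + (hilbert_adjoint C o\<^sub>L C)"
  let ?W = "(numerical_radius (B + C))\<^sup>2 + (numerical_radius (B - C))\<^sup>2"
  \<comment> \<open>For \<open>t = 1/2\<close> both weights agree, so the operators inside the radii
    are \<open>(1/2) *\<^sub>R (B + C)\<close> and \<open>(1/2) *\<^sub>R (B - C)\<close>. An upper
    bound on their radii is enough here.\<close>
  have half: "(numerical_radius ((1/2) *\<^sub>R T))\<^sup>2 \<le> (numerical_radius T)\<^sup>2 / 4"
    for T :: "'a \<Rightarrow>\<^sub>L 'a"
    using power_mono[OF numerical_radius_scaleR_le[of "1/2" T] numerical_radius_nonneg, of 2]
    by (simp add: power_divide)
  have "euclidean_operator_radius B C \<le> sqrt (norm ((1/4) *\<^sub>R ?N))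
      + 1 / sqrt 2 * sqrt ((numerical_radius ((1/2) *\<^sub>R (B + C)))\<^sup>2
                           + (numerical_radius ((1/2) *\<^sub>R (B - C)))\<^sup>2)"
  proof -
    have "(1/2)\<^sup>2 *\<^sub>R (hilbert_adjoint B o\<^sub>L B) + (1 - 1/2)\<^sup>2 *\<^sub>R (hilbert_adjoint C o\<^sub>L C)
        = (1/4) *\<^sub>R ?N"
      and "(1 - 1/2) *\<^sub>R B + (1/2) *\<^sub>R C = (1/2) *\<^sub>R (B + C)"
      and "(1 - 1/2) *\<^sub>R B - (1/2) *\<^sub>R C = (1/2) *\<^sub>R (B - C)"
      by (simp_all add: power_divide scaleR_add_right scaleR_diff_right)
    then show ?thesis
      using euclidean_operator_radius_le[OF assms, of "1/2"] by simp
  qed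
  also have "\<dots> \<le> sqrt (norm ((1/4) *\<^sub>R ?N)) + 1 / sqrt 2 * sqrt (?W / 4)"
    using half[of "B + C"] half[of "B - C"]
    by (intro add_left_mono mult_left_mono real_sqrt_le_mono) simp_all
  \<comment> \<open>Each factor \<open>1/4\<close> leaves its square root as
    \<open>1/2\<close>.\<close>
  also have "\<dots> = 1 / 2 * sqrt (norm ?N) + 1 / (2 * sqrt 2) * sqrt ?W"
    by (simp add: real_sqrt_divide)
  finally show "euclidean_operator_radius B C
      \<le> 1 / 2 * sqrt (norm ?N) + 1 / (2 * sqrt 2) * sqrt ?W" .
qed

end
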